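(* Let $m,n$ be positive integers and $a,b$ non-negative integers with $a+b=n$ and $a$ even. Let $x_1,\ldots,x_a,y_1,\ldots,y_b$ be complex numbers with $x_1+\cdots+x_a+y_1+\cdots+y_b=0$. Define \[ R_{1,4}(m,n;\tau)= mn\, q^{\frac{a}{4}}\sum_{\substack{r_1,\ldots,r_a,s_1,\ldots,s_b\in\mathbb{Z}\\ 2(r_1+\cdots+r_a+s_1+\cdots+s_b)+a=0}}q^{r_1^2+\cdots+r_a^2+s_1^2+\cdots+s_b^2+r_1+\cdots+r_a}e^{i(2r_1x_1+\cdots+2r_ax_a+2s_1y_1+\cdots+2s_by_b+x_1+\cdots+x_a)}. \] Let $S(z)=\sum_{k=0}^{mn-1}\prod_{j=1}^{a}\vartheta_1\!\left(z+x_j+\tfrac{k\pi}{mn}\Big|\tau\right)\prod_{i=1}^{b}\vartheta_4\!\left(z+y_i+\tfrac{k\pi}{mn}\Big|\tau\right)$. Then for all $z\in\mathbb{C}$: if $mn$ is even, $S(z)=R_{1,4}(m,n;\tau)\,\vartheta_3(mnz\,|\,m^2n\tau)$; if $mn$ is odd, $S(z)=R_{1,4}(m,n;\tau)\,\vartheta_4(mnz\,|\,m^2n\tau)$.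
   Context: Throughout, $\tau\in\mathbb{C}$ with $\Im(\tau)>0$, $q=e^{\pi i\tau}$, and $q^{\alpha}$ means $e^{\pi i\alpha\tau}$ for real $\alpha$. The Jacobi theta functions are $\vartheta_1(z|\tau)=-iq^{1/4}\sum_{n\in\mathbb{Z}}(-1)^nq^{n(n+1)}e^{(2n+1)iz}$, $\vartheta_2(z|\tau)=q^{1/4}\sum_{n\in\mathbb{Z}}q^{n(n+1)}e^{(2n+1)iz}$, $\vartheta_3(z|\tau)=\sum_{n\in\mathbb{Z}}q^{n^2}e^{2niz}$, $\vartheta_4(z|\tau)=\sum_{n\in\mathbb{Z}}(-1)^nq^{n^2}e^{2niz}$; and $\vartheta_j(z|m^2n\tau)$ denotes the same function with $\tau$ replaced by $m^2n\tau$. An empty product equals $1$. *)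

theory Defs
  imports "HOL-Analysis.Analysis"
begin

text \<open>The power \<open>q\<^sup>\<alpha>\<close> of the nome \<open>q = exp (\<pi> \<i> \<tau>)\<close>: the branch is fixed by \<open>\<tau>\<close>, so this is not
  the principal-branch \<^const>\<open>powr\<close> of \<open>q\<close>.\<close>
definition qpow :: "complex \<Rightarrow> real \<Rightarrow> complex" where
  "qpow \<tau> \<alpha> = exp (of_real pi * \<i> * of_real \<alpha> * \<tau>)"

definition theta1 :: "complex \<Rightarrow> complex \<Rightarrow> complex" where
  "theta1 z \<tau> = - \<i> * qpow \<tau> (1/4) *
     (\<Sum>\<^sub>\<infinity>n\<in>(UNIV::int set). (-1) powi n * qpow \<tau> (of_int (n * (n + 1))) * exp (of_int (2 * n + 1) * \<i> * z))"

definition theta2 :: "complex \<Rightarrow> complex \<Rightarrow> complex" where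
  "theta2 z \<tau> = qpow \<tau> (1/4) *
     (\<Sum>\<^sub>\<infinity>n\<in>(UNIV::int set). qpow \<tau> (of_int (n * (n + 1))) * exp (of_int (2 * n + 1) * \<i> * z))"

definition theta3 :: "complex \<Rightarrow> complex \<Rightarrow> complex" where
  "theta3 z \<tau> =
     (\<Sum>\<^sub>\<infinity>n\<in>(UNIV::int set). qpow \<tau> (of_int (n\<^sup>2)) * exp (of_int (2 * n) * \<i> * z))"

definition theta4 :: "complex \<Rightarrow> complex \<Rightarrow> complex" where
  "theta4 z \<tau> =
     (\<Sum>\<^sub>\<infinity>n\<in>(UNIV::int set). (-1) powi n * qpow \<tau> (of_int (n\<^sup>2)) * exp (of_int (2 * n) * \<i> * z))"

text \<open>A tuple \<open>(r\<^sub>1, \<dots>, r\<^sub>a)\<close> of integers is an extensional function on \<open>{1..a}\<close>, so that distinct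
  index functions are distinct tuples.\<close>
definition index14 :: "nat \<Rightarrow> nat \<Rightarrow> ((nat \<Rightarrow> int) \<times> (nat \<Rightarrow> int)) set" where
  "index14 a b = {(r, s). r \<in> {1..a} \<rightarrow>\<^sub>E UNIV \<and> s \<in> {1..b} \<rightarrow>\<^sub>E UNIV \<and>
     2 * ((\<Sum>j=1..a. r j) + (\<Sum>i=1..b. s i)) + int a = 0}"

definition R14 :: "nat \<Rightarrow> nat \<Rightarrow> nat \<Rightarrow> nat \<Rightarrow> (nat \<Rightarrow> complex) \<Rightarrow> (nat \<Rightarrow> complex) \<Rightarrow> complex \<Rightarrow> complex" where
  "R14 m n a b x y \<tau> = of_nat (m * n) * qpow \<tau> (of_nat a / 4) *
     (\<Sum>\<^sub>\<infinity>(r, s)\<in>index14 a b.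
        qpow \<tau> (of_int ((\<Sum>j=1..a. (r j)\<^sup>2) + (\<Sum>i=1..b. (s i)\<^sup>2) + (\<Sum>j=1..a. r j))) *
        exp (\<i> * ((\<Sum>j=1..a. 2 * of_int (r j) * x j) + (\<Sum>i=1..b. 2 * of_int (s i) * y i)
                 + (\<Sum>j=1..a. x j))))"

definition S14 :: "nat \<Rightarrow> nat \<Rightarrow> nat \<Rightarrow> nat \<Rightarrow> (nat \<Rightarrow> complex) \<Rightarrow> (nat \<Rightarrow> complex) \<Rightarrow> complex \<Rightarrow> complex \<Rightarrow> complex" where
  "S14 m n a b x y \<tau> z = (\<Sum>k=0..<m * n.
     (\<Prod>j=1..a. theta1 (z + x j + of_nat k * of_real pi / of_nat (m * n)) \<tau>) *
     (\<Prod>i=1..b. theta4 (z + y i + of_nat k * of_real pi / of_nat (m * n)) \<tau>))"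

end

theory Submission imports Defs begin

text \<open>
  Multiply out the absolutely convergent theta series. The term with indices \<open>(r, s)\<close> depends on \<open>z\<close>
  only through \<open>exp (2 \<i> M z)\<close> with \<open>M = \<Sum>r + \<Sum>s + a/2\<close>, so averaging over the shifts
  \<open>k \<pi> / (m n)\<close> keeps exactly the terms with \<open>M = m n l\<close> for an integer \<open>l\<close>. Subtracting \<open>m l\<close> from
  each of the \<open>n\<close> indices moves such a term to level \<open>M = 0\<close>: completing the square produces the factor
  \<open>q\<close> to the power \<open>m\<^sup>2 n l\<^sup>2\<close>, and the exponentials in \<open>x, y\<close> do not change because these sum
  to \<open>0\<close>. The double sum thus splits into \<open>R\<^sub>1\<^sub>,\<^sub>4\<close> times a theta series in \<open>l\<close> with sign
  \<open>(-1)\<close> to the power \<open>m n l\<close>.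
\<close>

declare One_nat_def [simp del]

section \<open>Powers of the nome and of a sign\<close>

lemma qpow_add: "qpow \<tau> (\<alpha> + \<beta>) = qpow \<tau> \<alpha> * qpow \<tau> \<beta>"
  by (simp add: qpow_def ring_distribs flip: exp_add)

lemma qpow_sum: "qpow \<tau> (\<Sum>j\<in>A. f j) = (\<Prod>j\<in>A. qpow \<tau> (f j))"
  by (induction A rule: infinite_finite_induct) (simp_all add: qpow_add, simp_all add: qpow_def)

lemma qpow_power: "qpow \<tau> \<alpha> ^ k = qpow \<tau> (of_nat k * \<alpha>)"
  by (induction k) (simp_all add: qpow_def ring_distribs flip: exp_add)

lemma qpow_of_nat_mult: "qpow (of_nat k * \<tau>) \<alpha> = qpow \<tau> (of_nat k * \<alpha>)"
  by (simp add: qpow_def algebra_simps)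

lemma norm_qpow: "norm (qpow \<tau> \<alpha>) = exp (- (pi * Im \<tau>) * \<alpha>)"
  by (simp add: qpow_def mult.commute mult.left_commute)

lemma power_int_sum:
  fixes c :: "'a::field"
  assumes "c \<noteq> 0"
  shows "c powi (\<Sum>j\<in>A. f j) = (\<Prod>j\<in>A. c powi f j)"
  using assms by (induction A rule: infinite_finite_induct) (simp_all add: power_int_add)

section \<open>Convergence of Gaussian sums over the integers\<close>

text \<open>Two copies of a geometric series cover the non-negative and the non-positive integers;
  the overlap at 0 does no harm to summability.\<close>

lemma summable_on_exp_neg_abs_int: "(\<lambda>n::int. exp (- of_int \<bar>n\<bar>) :: real) summable_on UNIV"
proof -
  have "summable (\<lambda>n. exp (- 1 :: real) ^ n)"
    by (rule summable_geometric) simp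
  then have *: "(\<lambda>n. exp (- of_nat n :: real)) summable_on UNIV"
    by (intro summable_nonneg_imp_summable_on) (simp_all flip: exp_of_nat_mult)
  have "(\<lambda>n::int. exp (- of_int \<bar>n\<bar>) :: real) summable_on range int"
    using * by (subst summable_on_reindex) (simp_all add: o_def inj_on_def)
  moreover have "(\<lambda>n::int. exp (- of_int \<bar>n\<bar>) :: real) summable_on range (\<lambda>n. - int n)"
    using * by (subst summable_on_reindex) (simp_all add: o_def inj_on_def)
  moreover have "range int \<union> range (\<lambda>n. - int n) = UNIV"
    by (auto simp: image_iff) (metis int_cases2)
  ultimately show ?thesis
    by (metis summable_on_union)
qed

text \<open>The quadratic part wins over any linear term, so a constant multiple of
  \<open>exp (- \<bar>n\<bar>)\<close> dominates. Applied to the norms of the theta terms with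
  \<open>A = pi * Im \<tau>\<close>.\<close>

lemma summable_on_exp_quadratic_int:
  fixes A B :: real
  assumes "A > 0"
  shows "(\<lambda>n::int. exp (- A * of_int (n\<^sup>2) + B * of_int n)) summable_on UNIV"
proof -
  \<comment> \<open>Chosen to complete the square:
    \<open>A * u\<^sup>2 - (\<bar>B\<bar> + 1) * u + D\<close> is a square over
    \<open>4 * A\<close>. The extra 1 leaves the decay \<open>- u\<close>.\<close>
  define D where "D = (\<bar>B\<bar> + 1)\<^sup>2 / (4 * A)"
  have "- A * of_int (n\<^sup>2) + B * of_int n \<le> D - of_int \<bar>n\<bar>" for n :: int
  proof -
    define u where "u = real_of_int \<bar>n\<bar>"
    have "0 \<le> (2 * A * u - (\<bar>B\<bar> + 1))\<^sup>2 / (4 * A)"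
      using assms by simp
    also have "\<dots> = A * u\<^sup>2 - (\<bar>B\<bar> + 1) * u + D"
      using assms by (simp add: D_def field_simps power2_eq_square)
    finally have "- A * u\<^sup>2 + \<bar>B\<bar> * u \<le> D - u"
      by (simp add: algebra_simps)
    moreover have "B * of_int n \<le> \<bar>B\<bar> * u"
      by (metis abs_ge_self abs_mult of_int_abs u_def)
    ultimately show ?thesis
      by (simp add: u_def)
  qed
  then have "exp (- A * of_int (n\<^sup>2) + B * of_int n) \<le> exp D * exp (- of_int \<bar>n\<bar>)" for n :: int
    by (simp flip: exp_add)
  then show ?thesis
    by (intro summable_on_comparison_test[OF summable_on_cmult_right[OF summable_on_exp_neg_abs_int]])
      auto
qed

section \<open>Multiplying out infinite sums\<close>

text \<open>For complex families summability is absolute, so the family of products is absolutely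
  summable and can be summed one variable at a time.\<close>

lemma has_sum_mult_Times:
  fixes f :: "'a \<Rightarrow> complex" and g :: "'b \<Rightarrow> complex"
  assumes "(f has_sum s) A" and "(g has_sum t) B"
  shows "((\<lambda>(x, y). f x * g y) has_sum (s * t)) (A \<times> B)"
proof -
  have f: "f summable_on A" "infsum f A = s" and g: "g summable_on B" "infsum g B = t"
    using assms by (auto simp: has_sum_iff)
  have nf: "(\<lambda>x. norm (f x)) summable_on A" and ng: "(\<lambda>x. norm (g x)) summable_on B"
    using f g by (simp_all flip: summable_on_iff_abs_summable_on_complex)
  have "(\<lambda>p. norm (case p of (x, y) \<Rightarrow> f x * g y)) summable_on A \<times> B"
    unfolding Infinite_Sum.abs_summable_on_Sigma_iff using nf ng
    by (auto simp: norm_mult infsum_cmult_right' infsum_nonneg abs_mult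
        intro!: summable_on_cmult_right summable_on_cmult_left)
  then have sm: "(\<lambda>(x, y). f x * g y) summable_on A \<times> B"
    by (rule abs_summable_summable)
  have "infsum (\<lambda>(x, y). f x * g y) (A \<times> B) = (\<Sum>\<^sub>\<infinity>x\<in>A. \<Sum>\<^sub>\<infinity>y\<in>B. f x * g y)"
    using infsum_Sigma'_banach[of "\<lambda>x y. f x * g y" A "\<lambda>_. B"] sm by simp
  also have "\<dots> = s * t"
    by (simp add: infsum_cmult_right' infsum_cmult_left' f g)
  finally show ?thesis
    using sm by (simp add: has_sum_iff)
qed

text \<open>Induction on \<open>A\<close>: a function on \<open>insert a A\<close> is a value at
  \<open>a\<close> together with a function on \<open>A\<close>, so one factor at a time is
  multiplied out by \<open>has_sum_mult_Times\<close>.\<close>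

lemma has_sum_prod_PiE:
  fixes f :: "'a \<Rightarrow> 'b \<Rightarrow> complex"
  assumes "finite A" and "\<And>x. x \<in> A \<Longrightarrow> (f x has_sum s x) (B x)"
  shows "((\<lambda>g. \<Prod>x\<in>A. f x (g x)) has_sum (\<Prod>x\<in>A. s x)) (PiE A B)"
  using assms
proof (induction A)
  case empty
  then show ?case by (simp add: has_sum_finiteI)
next
  case (insert a A)
  have "((\<lambda>(y, g). f a y * (\<Prod>x\<in>A. f x (g x))) has_sum (s a * (\<Prod>x\<in>A. s x))) (B a \<times> PiE A B)"
    using insert by (intro has_sum_mult_Times) auto
  moreover have "(\<Prod>x\<in>insert a A. f x ((g(a := y)) x)) = f a y * (\<Prod>x\<in>A. f x (g x))" for g y
    using insert.hyps by (auto intro!: prod.cong)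
  moreover have "inj_on (\<lambda>(y, g). g(a := y)) (B a \<times> PiE A B)"
    using insert.hyps(2) by (rule inj_combinator)
  ultimately show ?case
    using insert.hyps
    by (simp add: PiE_insert_eq has_sum_reindex o_def case_prod_unfold del: prod.insert fun_upd_apply)
      simp
qed

lemma has_sum_finite_sum:
  fixes f :: "'a \<Rightarrow> 'b \<Rightarrow> complex"
  assumes "\<And>k. k \<in> K \<Longrightarrow> (f k has_sum s k) A"
  shows "((\<lambda>x. \<Sum>k\<in>K. f k x) has_sum (\<Sum>k\<in>K. s k)) A"
  using assms by (induction K rule: infinite_finite_induct) (auto intro: has_sum_add)

section \<open>Convergence of the theta series\<close>

lemma has_sum_theta1:
  assumes "Im \<tau> > 0"
  shows "((\<lambda>n::int. - \<i> * qpow \<tau> (1/4) * ((-1) powi n * qpow \<tau> (of_int (n * (n + 1))) *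
           exp (of_int (2 * n + 1) * \<i> * z))) has_sum theta1 z \<tau>) UNIV"
proof -
  \<comment> \<open>Expanding \<open>n * (n + 1)\<close> and \<open>2 * n + 1\<close> in the norm of
    the term gives this Gaussian; the constant part of the exponent is split off as
    \<open>exp (- Im z)\<close>.\<close>
  have "(\<lambda>n::int. exp (- Im z) * exp (- (pi * Im \<tau>) * of_int (n\<^sup>2) +
      (- (pi * Im \<tau>) - 2 * Im z) * of_int n)) summable_on UNIV"
    using assms by (intro summable_on_cmult_right summable_on_exp_quadratic_int) simp
  then have "(\<lambda>n::int. norm ((-1) powi n * qpow \<tau> (of_int (n * (n + 1))) *
      exp (of_int (2 * n + 1) * \<i> * z))) summable_on UNIV"
  proof (rule summable_on_cong[THEN iffD1, rotated])
    fix n :: int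
    have "norm ((-1) powi n * qpow \<tau> (of_int (n * (n + 1))) * exp (of_int (2 * n + 1) * \<i> * z)) =
        exp (- (pi * Im \<tau>) * of_int (n * (n + 1)) + - (of_int (2 * n + 1) * Im z))"
      unfolding exp_add by (simp add: norm_mult norm_power_int norm_qpow)
    also have "\<dots> = exp (- Im z + (- (pi * Im \<tau>) * of_int (n\<^sup>2) + (- (pi * Im \<tau>) - 2 * Im z) * of_int n))"
      by (simp add: power2_eq_square algebra_simps)
    finally show "exp (- Im z) * exp (- (pi * Im \<tau>) * of_int (n\<^sup>2) + (- (pi * Im \<tau>) - 2 * Im z) * of_int n) =
        norm ((-1) powi n * qpow \<tau> (of_int (n * (n + 1))) * exp (of_int (2 * n + 1) * \<i> * z))"
      by (simp only: exp_add)
  qed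
  then show ?thesis
    unfolding theta1_def by (intro has_sum_cmult_right has_sum_infsum) (rule abs_summable_summable)
qed

lemma has_sum_theta4:
  assumes "Im \<tau> > 0"
  shows "((\<lambda>n::int. (-1) powi n * qpow \<tau> (of_int (n\<^sup>2)) * exp (of_int (2 * n) * \<i> * z))
           has_sum theta4 z \<tau>) UNIV"
proof -
  have "(\<lambda>n::int. exp (- (pi * Im \<tau>) * of_int (n\<^sup>2) + (- 2 * Im z) * of_int n)) summable_on UNIV"
    using assms by (intro summable_on_exp_quadratic_int) simp
  then have "(\<lambda>n::int. norm ((-1) powi n * qpow \<tau> (of_int (n\<^sup>2)) * exp (of_int (2 * n) * \<i> * z)))
      summable_on UNIV"
  proof (rule summable_on_cong[THEN iffD1, rotated])
    fix n :: int
    show "exp (- (pi * Im \<tau>) * of_int (n\<^sup>2) + (- 2 * Im z) * of_int n) =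
        norm ((-1) powi n * qpow \<tau> (of_int (n\<^sup>2)) * exp (of_int (2 * n) * \<i> * z))"
      unfolding exp_add by (simp add: norm_mult norm_power_int norm_qpow mult.commute)
  qed
  then show ?thesis
    unfolding theta4_def by (intro has_sum_infsum) (rule abs_summable_summable)
qed

text \<open>Follows from the series of \<open>theta4\<close> at \<open>z + pi / 2\<close>: the shift
  contributes \<open>exp (n * \<i> * pi)\<close>, which cancels the sign
  \<open>(-1) powi n\<close>.\<close>

lemma has_sum_theta3:
  assumes "Im \<tau> > 0"
  shows "((\<lambda>n::int. qpow \<tau> (of_int (n\<^sup>2)) * exp (of_int (2 * n) * \<i> * z))
           has_sum theta3 z \<tau>) UNIV"
proof -
  have "(-1) powi n * qpow \<tau> (of_int (n\<^sup>2)) * exp (of_int (2 * n) * \<i> * (z + of_real pi / 2)) =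
      qpow \<tau> (of_int (n\<^sup>2)) * exp (of_int (2 * n) * \<i> * z)" for n :: int
  proof -
    have arg: "of_int (2 * n) * \<i> * (z + of_real pi / 2) = of_int (2 * n) * \<i> * z + of_int n * (\<i> * of_real pi)"
      by (simp add: algebra_simps)
    have "exp (of_int n * (\<i> * of_real pi)) = (-1 :: complex) powi n"
      by (subst exp_power_int [symmetric]) simp
    moreover have "c * d * (e * c) = (c * c) * (d * e)" for c d e :: complex
      by (simp only: mult_ac)
    ultimately show ?thesis
      unfolding arg exp_add by (simp only: power_int_minus_one_mult_self mult_1_left)
  qed
  then have "((\<lambda>n::int. qpow \<tau> (of_int (n\<^sup>2)) * exp (of_int (2 * n) * \<i> * z))
      has_sum theta4 (z + of_real pi / 2) \<tau>) UNIV"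
    by (intro has_sum_cong[THEN iffD1, OF _ has_sum_theta4[OF assms, of "z + of_real pi / 2"]])
  then show ?thesis
    by (simp add: theta3_def has_sum_iff)
qed

section \<open>The averaging filter\<close>

text \<open>A geometric sum in an \<open>N\<close>-th root of unity \<open>w\<close>, which is 1
  exactly when \<open>N\<close> divides \<open>M\<close>; otherwise \<open>w ^ N = 1\<close> makes
  the sum vanish.\<close>

lemma sum_roots_of_unity:
  fixes N :: nat and M :: int
  assumes "N > 0"
  shows "(\<Sum>k=0..<N. exp (2 * of_int M * \<i> * (of_nat k * of_real pi / of_nat N))) =
           (if int N dvd M then of_nat N else 0 :: complex)"
proof -
  define w where "w = exp (2 * of_int M * \<i> * of_real pi / of_nat N :: complex)"
  have eq: "(\<Sum>k=0..<N. exp (2 * of_int M * \<i> * (of_nat k * of_real pi / of_nat N))) = (\<Sum>k<N. w ^ k)"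
    by (simp add: w_def mult_ac atLeast0LessThan flip: exp_of_nat_mult)
  have wN: "w ^ N = 1"
    using assms exp_integer_2pi[of "of_int M"] by (simp add: w_def mult_ac flip: exp_of_nat_mult)
  have w1: "w = 1 \<longleftrightarrow> int N dvd M"
  proof -
    have "w = 1 \<longleftrightarrow> (\<exists>l::int. 2 * of_int M * pi / of_nat N = of_int (2 * l) * pi)"
      by (simp add: w_def exp_eq_1)
    also have "\<dots> \<longleftrightarrow> (\<exists>l::int. of_int M = (of_int (int N * l) :: real))"
      using assms by (simp add: field_simps)
    also have "\<dots> \<longleftrightarrow> int N dvd M"
      unfolding of_int_eq_iff dvd_def by blast
    finally show ?thesis .
  qed
  show ?thesis
    using wN w1 unfolding eq by (cases "w = 1") (simp_all add: geometric_sum)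
qed

section \<open>Terms of the multiplied-out product and their shifts\<close>

text \<open>The summand of \<open>R14\<close>, taken at arbitrary index tuples and not just those in
  \<open>index14\<close>, so that it can be followed under shifts.\<close>

definition summand14 ::
    "nat \<Rightarrow> nat \<Rightarrow> (nat \<Rightarrow> complex) \<Rightarrow> (nat \<Rightarrow> complex) \<Rightarrow> complex \<Rightarrow> (nat \<Rightarrow> int) \<Rightarrow> (nat \<Rightarrow> int) \<Rightarrow> complex"
  where "summand14 a b x y \<tau> r s =
    qpow \<tau> (of_int ((\<Sum>j=1..a. (r j)\<^sup>2) + (\<Sum>i=1..b. (s i)\<^sup>2) + (\<Sum>j=1..a. r j))) *
    exp (\<i> * ((\<Sum>j=1..a. 2 * of_int (r j) * x j) + (\<Sum>i=1..b. 2 * of_int (s i) * y i)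
             + (\<Sum>j=1..a. x j)))"

text \<open>Half the frequency in \<open>z\<close> of the \<open>(r, s)\<close> term, assuming \<open>a\<close> even.\<close>
definition level14 :: "nat \<Rightarrow> nat \<Rightarrow> (nat \<Rightarrow> int) \<Rightarrow> (nat \<Rightarrow> int) \<Rightarrow> int" where
  "level14 a b r s = (\<Sum>j=1..a. r j) + (\<Sum>i=1..b. s i) + int (a div 2)"

lemma index14_iff_level14:
  assumes "even a"
  shows "(r, s) \<in> index14 a b \<longleftrightarrow>
    r \<in> {1..a} \<rightarrow>\<^sub>E UNIV \<and> s \<in> {1..b} \<rightarrow>\<^sub>E UNIV \<and> level14 a b r s = 0"
  using assms by (auto simp: index14_def level14_def elim!: evenE)

text \<open>Evenness of \<open>a\<close> turns \<open>(- \<i>) ^ a\<close> into \<open>(-1)\<close>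
  to the power \<open>a div 2\<close>, exactly what completes the signs of the indices to
  \<open>(-1) powi level14 a b r s\<close>.\<close>

lemma theta_product_term:
  assumes "even a"
  shows "(\<Prod>j=1..a. - \<i> * qpow \<tau> (1/4) * ((-1) powi r j * qpow \<tau> (of_int (r j * (r j + 1))) *
             exp (of_int (2 * r j + 1) * \<i> * (x j + w)))) *
         (\<Prod>i=1..b. (-1) powi s i * qpow \<tau> (of_int ((s i)\<^sup>2)) * exp (of_int (2 * s i) * \<i> * (y i + w))) =
         qpow \<tau> (of_nat a / 4) * (-1) powi level14 a b r s * summand14 a b x y \<tau> r s *
           exp (2 * of_int (level14 a b r s) * \<i> * w)"
proof -
  obtain c where c: "a = 2 * c"
    using assms by blast
  have "(- \<i>) ^ a = (-1) powi int c"
    by (simp add: c power_mult)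
  then have sgn: "(- \<i>) ^ a * (\<Prod>j=1..a. (-1) powi r j) * (\<Prod>i=1..b. (-1) powi s i) =
      (-1) powi level14 a b r s"
    by (simp add: level14_def power_int_add c flip: power_int_sum)
  have q: "(\<Prod>j=1..a. qpow \<tau> (of_int (r j * (r j + 1)))) * (\<Prod>i=1..b. qpow \<tau> (of_int ((s i)\<^sup>2))) =
      qpow \<tau> (of_int ((\<Sum>j=1..a. (r j)\<^sup>2) + (\<Sum>i=1..b. (s i)\<^sup>2) + (\<Sum>j=1..a. r j)))"
    unfolding qpow_sum[symmetric] qpow_add[symmetric]
    by (simp add: sum.distrib power2_eq_square ring_distribs add_ac)
  \<comment> \<open>The coefficients of \<open>w\<close> add up to twice the level: the
    \<open>a\<close> ones in \<open>2 * r j + 1\<close> account for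
    \<open>2 * (a div 2)\<close>.\<close>
  have "(\<Sum>j=1..a. of_int (2 * r j + 1) * \<i> * (x j + w)) + (\<Sum>i=1..b. of_int (2 * s i) * \<i> * (y i + w)) =
      \<i> * ((\<Sum>j=1..a. 2 * of_int (r j) * x j) + (\<Sum>i=1..b. 2 * of_int (s i) * y i) + (\<Sum>j=1..a. x j)) +
      2 * of_int (level14 a b r s) * \<i> * w"
    by (simp add: level14_def c sum.distrib sum_distrib_left sum_distrib_right algebra_simps)
  then have e: "(\<Prod>j=1..a. exp (of_int (2 * r j + 1) * \<i> * (x j + w))) *
      (\<Prod>i=1..b. exp (of_int (2 * s i) * \<i> * (y i + w))) =
      exp (\<i> * ((\<Sum>j=1..a. 2 * of_int (r j) * x j) + (\<Sum>i=1..b. 2 * of_int (s i) * y i) + (\<Sum>j=1..a. x j))) *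
      exp (2 * of_int (level14 a b r s) * \<i> * w)"
    by (simp flip: exp_sum exp_add)
  have "qpow \<tau> (1/4) ^ a = qpow \<tau> (of_nat a / 4)"
    by (simp add: qpow_power)
  moreover have "(\<Prod>j=1..a. - \<i> * qpow \<tau> (1/4) * ((-1) powi r j * qpow \<tau> (of_int (r j * (r j + 1))) *
        exp (of_int (2 * r j + 1) * \<i> * (x j + w)))) *
      (\<Prod>i=1..b. (-1) powi s i * qpow \<tau> (of_int ((s i)\<^sup>2)) * exp (of_int (2 * s i) * \<i> * (y i + w))) =
      qpow \<tau> (1/4) ^ a * ((- \<i>) ^ a * (\<Prod>j=1..a. (-1) powi r j) * (\<Prod>i=1..b. (-1) powi s i)) *
      ((\<Prod>j=1..a. qpow \<tau> (of_int (r j * (r j + 1)))) * (\<Prod>i=1..b. qpow \<tau> (of_int ((s i)\<^sup>2)))) *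
      ((\<Prod>j=1..a. exp (of_int (2 * r j + 1) * \<i> * (x j + w))) *
       (\<Prod>i=1..b. exp (of_int (2 * s i) * \<i> * (y i + w))))"
    by (simp only: prod.distrib prod_constant card_atLeastAtMost add_diff_cancel_right' Suc_eq_plus1 mult_ac)
  ultimately show ?thesis
    unfolding summand14_def sgn q e by (simp only: mult_ac)
qed

lemma level14_shift:
  "level14 a b (\<lambda>j\<in>{1..a}. r j + t) (\<lambda>i\<in>{1..b}. s i + t) = level14 a b r s + int (a + b) * t"
  by (simp add: level14_def sum.distrib algebra_simps)

text \<open>In the exponent of \<open>q\<close> the terms linear in \<open>t\<close> collect to
  \<open>2 * t\<close> times the level, which is 0. In the exponential the change is a multiple of
  the sum of all \<open>x j\<close> and \<open>y i\<close>, also 0.\<close>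

lemma summand14_shift:
  assumes "even a" and "(\<Sum>j=1..a. x j) + (\<Sum>i=1..b. y i) = 0" and "level14 a b r s = 0"
  shows "summand14 a b x y \<tau> (\<lambda>j\<in>{1..a}. r j + t) (\<lambda>i\<in>{1..b}. s i + t) =
         qpow \<tau> (of_int (int (a + b) * t\<^sup>2)) * summand14 a b x y \<tau> r s"
proof -
  have "(\<Sum>j=1..a. (r j + t)\<^sup>2) + (\<Sum>i=1..b. (s i + t)\<^sup>2) + (\<Sum>j=1..a. r j + t) =
      int (a + b) * t\<^sup>2 + ((\<Sum>j=1..a. (r j)\<^sup>2) + (\<Sum>i=1..b. (s i)\<^sup>2) + (\<Sum>j=1..a. r j))
      + 2 * t * level14 a b r s"
    using assms(1)
    by (auto simp: level14_def power2_sum sum.distrib sum_distrib_left algebra_simps elim!: evenE)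
  moreover have "(\<Sum>j=1..a. 2 * of_int (r j + t) * x j) + (\<Sum>i=1..b. 2 * of_int (s i + t) * y i) =
      (\<Sum>j=1..a. 2 * of_int (r j) * x j) + (\<Sum>i=1..b. 2 * of_int (s i) * y i)
      + 2 * of_int t * ((\<Sum>j=1..a. x j) + (\<Sum>i=1..b. y i))"
    by (simp add: sum.distrib sum_distrib_left algebra_simps)
  ultimately show ?thesis
    using assms(2,3) by (simp add: summand14_def mult.assoc flip: qpow_add)
qed

text \<open>Adding \<open>m * l\<close> to all \<open>n\<close> indices raises the level from 0 to
  \<open>m * n * l\<close>. Hence \<open>l\<close> is recovered as the level divided by
  \<open>m * n\<close>, and subtracting \<open>m * l\<close> inverts the map.\<close>

lemma bij_betw_shift_index14:
  assumes "even a" and "a + b = n" and "m * n > 0"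
  shows "bij_betw (\<lambda>(l, r, s). (\<lambda>j\<in>{1..a}. r j + int m * l, \<lambda>i\<in>{1..b}. s i + int m * l))
    (UNIV \<times> index14 a b)
    {(r, s). r \<in> {1..a} \<rightarrow>\<^sub>E UNIV \<and> s \<in> {1..b} \<rightarrow>\<^sub>E UNIV \<and> int (m * n) dvd level14 a b r s}"
    (is "bij_betw ?f _ ?D")
proof (rule bij_betw_byWitness[where f' = "\<lambda>(r, s). let l = level14 a b r s div int (m * n) in
      (l, \<lambda>j\<in>{1..a}. r j - int m * l, \<lambda>i\<in>{1..b}. s i - int m * l)"])
  show "?f ` (UNIV \<times> index14 a b) \<subseteq> ?D"
    using assms by (auto simp: index14_iff_level14 level14_shift)
next
  show "(\<lambda>(r, s). let l = level14 a b r s div int (m * n) in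
      (l, \<lambda>j\<in>{1..a}. r j - int m * l, \<lambda>i\<in>{1..b}. s i - int m * l)) ` ?D \<subseteq> UNIV \<times> index14 a b"
    using assms level14_shift[of a b _ "- (int m * _)"]
    by (auto simp: index14_iff_level14 Let_def mult_ac elim!: dvdE)
next
  show "\<forall>p\<in>UNIV \<times> index14 a b. (case ?f p of (r, s) \<Rightarrow> let l = level14 a b r s div int (m * n) in
      (l, \<lambda>j\<in>{1..a}. r j - int m * l, \<lambda>i\<in>{1..b}. s i - int m * l)) = p"
    using assms
    by (auto simp: index14_iff_level14 level14_shift Let_def PiE_def extensional_def fun_eq_iff)
next
  show "\<forall>p\<in>?D. ?f (case p of (r, s) \<Rightarrow> let l = level14 a b r s div int (m * n) in
      (l, \<lambda>j\<in>{1..a}. r j - int m * l, \<lambda>i\<in>{1..b}. s i - int m * l)) = p"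
    by (auto simp: Let_def PiE_def extensional_def fun_eq_iff)
qed

section \<open>Averaging, regrouping by level and factoring\<close>

theorem theorem1p10:
  fixes m n a b :: nat and x y :: "nat \<Rightarrow> complex" and \<tau> :: complex
  assumes "Im \<tau> > 0"
    and "m > 0" and "n > 0" and "a + b = n" and "even a"
    and "(\<Sum>j=1..a. x j) + (\<Sum>i=1..b. y i) = 0"
  shows "\<forall>z. (even (m * n) \<longrightarrow>
                S14 m n a b x y \<tau> z = R14 m n a b x y \<tau> * theta3 (of_nat (m * n) * z) (of_nat (m\<^sup>2 * n) * \<tau>)) \<and>
             (odd (m * n) \<longrightarrow>
                S14 m n a b x y \<tau> z = R14 m n a b x y \<tau> * theta4 (of_nat (m * n) * z) (of_nat (m\<^sup>2 * n) * \<tau>))"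
proof
  fix z :: complex
  define N where "N = m * n"
  have N: "N > 0"
    using assms by (simp add: N_def)
  define T where "T = ({1..a} \<rightarrow>\<^sub>E (UNIV :: int set)) \<times> ({1..b} \<rightarrow>\<^sub>E (UNIV :: int set))"
  define D where "D = {(r, s). r \<in> {1..a} \<rightarrow>\<^sub>E UNIV \<and> s \<in> {1..b} \<rightarrow>\<^sub>E UNIV \<and> int N dvd level14 a b r s}"
  define G where "G = (\<lambda>(r, s). qpow \<tau> (of_nat a / 4) * (-1) powi level14 a b r s *
    summand14 a b x y \<tau> r s * exp (2 * of_int (level14 a b r s) * \<i> * z))"
  \<comment> \<open>The factor that \<open>G\<close> acquires under the shift by
    \<open>m * l\<close>; up to the sign, it is the term of a theta series in
    \<open>l\<close>.\<close>
  define th where "th = (\<lambda>l::int. (-1) powi (int N * l) *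
    (qpow (of_nat (m\<^sup>2 * n) * \<tau>) (of_int (l\<^sup>2)) * exp (of_int (2 * l) * \<i> * (of_nat N * z))))"

  \<comment> \<open>The product is multiplied out at a free point \<open>w\<close>, to be
    specialised to each shifted argument \<open>z + k * pi / N\<close>.\<close>
  have "((\<lambda>(r, s).
      (\<Prod>j=1..a. - \<i> * qpow \<tau> (1/4) * ((-1) powi r j * qpow \<tau> (of_int (r j * (r j + 1))) *
         exp (of_int (2 * r j + 1) * \<i> * (x j + w)))) *
      (\<Prod>i=1..b. (-1) powi s i * qpow \<tau> (of_int ((s i)\<^sup>2)) * exp (of_int (2 * s i) * \<i> * (y i + w))))
      has_sum ((\<Prod>j=1..a. theta1 (x j + w) \<tau>) * (\<Prod>i=1..b. theta4 (y i + w) \<tau>))) T" for w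
    unfolding T_def
    by (intro has_sum_mult_Times has_sum_prod_PiE has_sum_theta1 has_sum_theta4 assms) simp_all
  then have prod_sum: "((\<lambda>(r, s). qpow \<tau> (of_nat a / 4) * (-1) powi level14 a b r s *
      summand14 a b x y \<tau> r s * exp (2 * of_int (level14 a b r s) * \<i> * w))
      has_sum ((\<Prod>j=1..a. theta1 (x j + w) \<tau>) * (\<Prod>i=1..b. theta4 (y i + w) \<tau>))) T" for w
    unfolding theta_product_term[OF \<open>even a\<close>] .
  have "((\<lambda>p. \<Sum>k=0..<N. (\<lambda>(r, s). qpow \<tau> (of_nat a / 4) * (-1) powi level14 a b r s *
      summand14 a b x y \<tau> r s *
      exp (2 * of_int (level14 a b r s) * \<i> * (z + of_nat k * of_real pi / of_nat N))) p)
      has_sum S14 m n a b x y \<tau> z) T"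
    using has_sum_finite_sum[of "{0..<N}", OF prod_sum[of "z + of_nat _ * of_real pi / of_nat N"]]
    by (simp add: S14_def N_def add_ac)
  moreover have "(\<Sum>k=0..<N. (\<lambda>(r, s). qpow \<tau> (of_nat a / 4) * (-1) powi level14 a b r s *
      summand14 a b x y \<tau> r s *
      exp (2 * of_int (level14 a b r s) * \<i> * (z + of_nat k * of_real pi / of_nat N))) p) =
      G p * (if int N dvd (case p of (r, s) \<Rightarrow> level14 a b r s) then of_nat N else 0)" for p
    unfolding G_def sum_roots_of_unity[OF N, symmetric]
    by (simp add: case_prod_unfold distrib_left exp_add sum_distrib_left mult_ac)
  ultimately have "((\<lambda>p. G p * (if int N dvd (case p of (r, s) \<Rightarrow> level14 a b r s) then of_nat N else 0))
      has_sum S14 m n a b x y \<tau> z) T"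
    by simp
  \<comment> \<open>The averaged term vanishes unless \<open>N\<close> divides the level, so the sum
    over \<open>T\<close> is already the sum over \<open>D\<close>.\<close>
  also have "?this \<longleftrightarrow> ((\<lambda>p. of_nat N * G p) has_sum S14 m n a b x y \<tau> z) D"
    by (rule has_sum_cong_neutral) (auto simp: T_def D_def)
  finally have SD: "((\<lambda>p. of_nat N * G p) has_sum S14 m n a b x y \<tau> z) D" .

  \<comment> \<open>Level 0 is divisible by \<open>N\<close>. There the sign and the exponential in
    \<open>z\<close> are both 1, so this part of the sum is \<open>R14\<close> and is free of
    \<open>z\<close>.\<close>
  have "index14 a b \<subseteq> D"
    using \<open>even a\<close> by (clarsimp simp: D_def index14_iff_level14)
  then have "(\<lambda>p. of_nat N * G p) summable_on index14 a b"
    using SD by (meson has_sum_imp_summable summable_on_subset_banach)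
  moreover have "of_nat N * G p = of_nat N * qpow \<tau> (of_nat a / 4) * (case p of (r, s) \<Rightarrow> summand14 a b x y \<tau> r s)"
    if "p \<in> index14 a b" for p
    using that \<open>even a\<close> by (cases p) (simp add: G_def index14_iff_level14)
  then have "infsum (\<lambda>p. of_nat N * G p) (index14 a b) = R14 m n a b x y \<tau>"
    unfolding R14_def N_def[symmetric] summand14_def[symmetric] infsum_cmult_right'[symmetric]
    by (rule infsum_cong)
  ultimately have R: "((\<lambda>p. of_nat N * G p) has_sum R14 m n a b x y \<tau>) (index14 a b)"
    by (simp add: has_sum_iff)

  have shift: "G (\<lambda>j\<in>{1..a}. r j + int m * l, \<lambda>i\<in>{1..b}. s i + int m * l) = th l * G (r, s)"
    if "(r, s) \<in> index14 a b" for l r s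
  proof -
    have lev: "level14 a b r s = 0"
      using that \<open>even a\<close> by (simp add: index14_iff_level14)
    have "level14 a b (\<lambda>j\<in>{1..a}. r j + int m * l) (\<lambda>i\<in>{1..b}. s i + int m * l) = int N * l"
      by (simp add: level14_shift lev N_def assms(4) flip: assms(4))
    moreover have "qpow \<tau> (of_int (int (a + b) * (int m * l)\<^sup>2)) = qpow (of_nat (m\<^sup>2 * n) * \<tau>) (of_int (l\<^sup>2))"
      unfolding qpow_of_nat_mult by (simp add: \<open>a + b = n\<close> power_mult_distrib mult_ac)
    ultimately show ?thesis
      unfolding G_def th_def by (simp add: summand14_shift assms lev mult_ac)
  qed
  \<comment> \<open>Pulling the sum over \<open>D\<close> back along the bijection makes each term a
    product of a function of \<open>l\<close> and a function of the level-0 tuple.\<close>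
  have S: "((\<lambda>(l, p). th l * (of_nat N * G p)) has_sum S14 m n a b x y \<tau> z) (UNIV \<times> index14 a b)"
  proof -
    have "bij_betw (\<lambda>(l, r, s). (\<lambda>j\<in>{1..a}. r j + int m * l, \<lambda>i\<in>{1..b}. s i + int m * l))
        (UNIV \<times> index14 a b) D"
      unfolding D_def N_def using N assms by (intro bij_betw_shift_index14) (simp_all add: N_def)
    from has_sum_reindex_bij_betw[OF this, of "\<lambda>p. of_nat N * G p"] SD
    have "((\<lambda>(l, r, s). of_nat N * G (\<lambda>j\<in>{1..a}. r j + int m * l, \<lambda>i\<in>{1..b}. s i + int m * l))
        has_sum S14 m n a b x y \<tau> z) (UNIV \<times> index14 a b)"
      by (simp add: case_prod_unfold)
    then show ?thesis
      by (rule has_sum_cong[THEN iffD1, rotated]) (auto simp: shift)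
  qed
  \<comment> \<open>The product of the sum \<open>t\<close> of \<open>th\<close> with
    \<open>R14\<close> is a sum of the same double family, so uniqueness of sums gives the
    factorisation.\<close>
  have main: "S14 m n a b x y \<tau> z = R14 m n a b x y \<tau> * t" if "(th has_sum t) UNIV" for t
    using has_sum_unique[OF S has_sum_mult_Times[OF that R]] by (simp add: mult.commute)
  have im: "Im (of_nat (m\<^sup>2 * n) * \<tau>) > 0"
    using assms by simp
  \<comment> \<open>The parity of \<open>N\<close> enters only here:
    \<open>(-1) powi (N * l)\<close> is 1 for even \<open>N\<close> and \<open>(-1) powi l\<close>
    for odd \<open>N\<close>, giving \<open>theta3\<close> and \<open>theta4\<close>
    respectively.\<close>
  have "th = (\<lambda>l. qpow (of_nat (m\<^sup>2 * n) * \<tau>) (of_int (l\<^sup>2)) * exp (of_int (2 * l) * \<i> * (of_nat N * z)))"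
    if "even N"
    using that by (simp add: th_def fun_eq_iff power_int_minus_left)
  moreover have "th = (\<lambda>l. (-1) powi l * qpow (of_nat (m\<^sup>2 * n) * \<tau>) (of_int (l\<^sup>2)) *
      exp (of_int (2 * l) * \<i> * (of_nat N * z)))" if "odd N"
    using that by (simp add: th_def fun_eq_iff power_int_minus_left)
  ultimately show "(even (m * n) \<longrightarrow>
      S14 m n a b x y \<tau> z = R14 m n a b x y \<tau> * theta3 (of_nat (m * n) * z) (of_nat (m\<^sup>2 * n) * \<tau>)) \<and>
    (odd (m * n) \<longrightarrow>
      S14 m n a b x y \<tau> z = R14 m n a b x y \<tau> * theta4 (of_nat (m * n) * z) (of_nat (m\<^sup>2 * n) * \<tau>))"
    using main has_sum_theta3[OF im, of "of_nat N * z"] has_sum_theta4[OF im, of "of_nat N * z"]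
    by (simp add: N_def)
qed

end
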